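(* Let $\widehat E=E+\varepsilon E_0$ and $\widehat F=F+\varepsilon F_0$ be elements of $\mathbb{D}_n^{\rm CM}$. Then $\widehat E\overset{{\rm D}\text{-}\#}{\leq}\widehat F$ (D-sharp partial order) if and only if $\widehat E\overset{\rm D}{\leq}\widehat F$ (Dual-minus partial order) and $$EF=FE,\qquad (F_0-E_0)EE^{\#}=(E-F)E_0E^{\#},\qquad EE^{\#}(F_0-E_0)=E^{\#}E_0(E-F).$$
   Context: $\varepsilon$ is the dual unit: $\varepsilon\neq 0$, $\varepsilon^2=0$, commuting with reals. $\mathbb{D}^{m\times n}$ is the set of $m\times n$ dual matrices $\widehat E=E+\varepsilon E_0$ with $E,E_0\in\mathbb{R}^{m\times n}$, with the obvious addition, multiplication and transpose $\widehat E^{T}=E^T+\varepsilon E_0^T$. The dual Moore-Penrose generalized inverse (DMPGI) of $\widehat E\in\mathbb{D}^{m\times n}$ is the unique $\widehat X\in\mathbb{D}^{n\times m}$, if it exists, with $\widehat E\widehat X\widehat E=\widehat E$, $\widehat X\widehat E\widehat X=\widehat X$, $(\widehat E\widehat X)^T=\widehat E\widehat X$, $(\widehat X\widehat E)^T=\widehat X\widehat E$. The dual group generalized inverse (DGGI) $\widehat E^{\#}$ of $\widehat E\in\mathbb{D}^{n\times n}$ is the $\widehat X\in\mathbb{D}^{n\times n}$, if it exists, with $\widehat E\widehat X\widehat E=\widehat E$, $\widehat X\widehat E\widehat X=\widehat X$, $\widehat E\widehat X=\widehat X\widehat E$. $\mathbb{D}_n^{\rm CM}$ is the set of dual matrices in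 $\mathbb{D}^{n\times n}$ of dual index one, i.e. (equivalently) those whose DGGI exists; for $\widehat E=E+\varepsilon E_0\in\mathbb{D}_n^{\rm CM}$ the DMPGI of $\widehat E$ exists, and the ordinary group inverse $E^{\#}$ of the real matrix $E$ (the unique $X$ with $EXE=E$, $XEX=X$, $EX=XE$) exists. Minus partial order on real matrices of the same size: $E\leq F$ means $\mathrm{rk}(F-E)=\mathrm{rk}(F)-\mathrm{rk}(E)$. Dual-minus partial order: for dual matrices $\widehat E,\widehat F$ of the same size whose DMPGIs exist, $\widehat E\overset{\rm D}{\leq}\widehat F$ means that $E\leq F$ and the DMPGI of $\widehat F-\widehat E$ exists. D-sharp partial order: for $\widehat E,\widehat F\in\mathbb{D}_n^{\rm CM}$, $\widehat E\overset{{\rm D}\text{-}\#}{\leq}\widehat F$ means $\widehat E^{\#}\widehat E=\widehat E^{\#}\widehat F$ and $\widehat E\widehat E^{\#}=\widehat F\widehat E^{\#}$. *)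

theory Defs
  imports "HOL-Analysis.Analysis"
begin

text \<open>Dual numbers \<open>a + \<epsilon> b\<close> with real \<open>a\<close>, \<open>b\<close> and \<open>\<epsilon>\<^sup>2 = 0\<close>.\<close>

datatype dual_num = Dual (std_part: real) (inf_part: real)

lemma dual_num_eq_iff: "x = y \<longleftrightarrow> std_part x = std_part y \<and> inf_part x = inf_part y"
  by (cases x; cases y) simp

instantiation dual_num :: "{comm_ring_1, real_algebra_1}"
begin

definition zero_dual_num :: dual_num where "0 = Dual 0 0"
definition one_dual_num :: dual_num where "1 = Dual 1 0"
definition plus_dual_num :: "dual_num \<Rightarrow> dual_num \<Rightarrow> dual_num" where
  "x + y = Dual (std_part x + std_part y) (inf_part x + inf_part y)"
definition uminus_dual_num :: "dual_num \<Rightarrow> dual_num" where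
  "- x = Dual (- std_part x) (- inf_part x)"
definition minus_dual_num :: "dual_num \<Rightarrow> dual_num \<Rightarrow> dual_num" where
  "x - y = Dual (std_part x - std_part y) (inf_part x - inf_part y)"
definition times_dual_num :: "dual_num \<Rightarrow> dual_num \<Rightarrow> dual_num" where
  "x * y = Dual (std_part x * std_part y) (std_part x * inf_part y + inf_part x * std_part y)"
definition scaleR_dual_num :: "real \<Rightarrow> dual_num \<Rightarrow> dual_num" where
  "r *\<^sub>R x = Dual (r * std_part x) (r * inf_part x)"

instance
  by standard
    (simp_all add: zero_dual_num_def one_dual_num_def plus_dual_num_def uminus_dual_num_def
      minus_dual_num_def times_dual_num_def scaleR_dual_num_def dual_num_eq_iff algebra_simps)

end

definition dual_unit :: dual_num ("\<epsilon>") where "\<epsilon> = Dual 0 1"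

lemma dual_unit_nonzero: "\<epsilon> \<noteq> 0"
  by (simp add: dual_unit_def zero_dual_num_def)

lemma dual_unit_square: "\<epsilon> ^ 2 = 0"
  by (simp add: dual_unit_def power2_eq_square zero_dual_num_def times_dual_num_def)

lemma dual_num_expansion: "of_real a + \<epsilon> * of_real b = Dual a b"
  by (simp add: dual_unit_def of_real_def times_dual_num_def plus_dual_num_def
      scaleR_dual_num_def one_dual_num_def)


text \<open>A dual matrix is a matrix over \<^typ>\<open>dual_num\<close>; sum, product and transpose are
  the library ones. \<open>dual_mat E E0\<close> is \<open>E + \<epsilon> E\<^sub>0\<close>.\<close>

definition dual_mat :: "real^'n^'m \<Rightarrow> real^'n^'m \<Rightarrow> dual_num^'n^'m" where
  "dual_mat E E0 = (\<chi> i j. of_real (E $ i $ j) + \<epsilon> * of_real (E0 $ i $ j))"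

definition std_mat :: "dual_num^'n^'m \<Rightarrow> real^'n^'m" where
  "std_mat A = (\<chi> i j. std_part (A $ i $ j))"

definition inf_mat :: "dual_num^'n^'m \<Rightarrow> real^'n^'m" where
  "inf_mat A = (\<chi> i j. inf_part (A $ i $ j))"

lemma std_mat_dual_mat [simp]: "std_mat (dual_mat E E0) = E"
  by (simp add: std_mat_def dual_mat_def dual_num_expansion vec_eq_iff)

lemma inf_mat_dual_mat [simp]: "inf_mat (dual_mat E E0) = E0"
  by (simp add: inf_mat_def dual_mat_def dual_num_expansion vec_eq_iff)

lemma dual_mat_std_inf [simp]: "dual_mat (std_mat A) (inf_mat A) = A"
  by (simp add: std_mat_def inf_mat_def dual_mat_def dual_num_expansion vec_eq_iff)


text \<open>DMPGI: dual Moore-Penrose generalized inverse. It need not exist, since \<open>\<epsilon>\<close> is nilpotent.\<close>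

definition is_DMPGI :: "dual_num^'n^'m \<Rightarrow> dual_num^'m^'n \<Rightarrow> bool" where
  "is_DMPGI A X \<longleftrightarrow>
     A ** X ** A = A \<and> X ** A ** X = X \<and>
     transpose (A ** X) = A ** X \<and> transpose (X ** A) = X ** A"

definition has_DMPGI :: "dual_num^'n^'m \<Rightarrow> bool" where
  "has_DMPGI A \<longleftrightarrow> (\<exists>X. is_DMPGI A X)"

text \<open>The same equations define the group inverse of a real matrix and the dual
  group generalized inverse (DGGI) of a dual matrix. \<open>A\<^sup>#\<close> is meaningful only when a group
  inverse exists; it is then unique.\<close>

definition is_group_inverse :: "'a::semiring_1^'n^'n \<Rightarrow> 'a^'n^'n \<Rightarrow> bool" where
  "is_group_inverse A X \<longleftrightarrow> A ** X ** A = A \<and> X ** A ** X = X \<and> A ** X = X ** A"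

definition group_inverse :: "'a::semiring_1^'n^'n \<Rightarrow> 'a^'n^'n"  ("(_\<^sup>#)" [1000] 999) where
  "A\<^sup># = (THE X. is_group_inverse A X)"

lemma is_group_inverse_unique:
  fixes A X Y :: "'a::semiring_1^'n^'n"
  assumes X: "is_group_inverse A X" and Y: "is_group_inverse A Y"
  shows "X = Y"
proof -
  have x: "A ** X ** A = A" "X ** A ** X = X" "A ** X = X ** A"
    and y: "A ** Y ** A = A" "Y ** A ** Y = Y" "A ** Y = Y ** A"
    using X Y unfolding is_group_inverse_def by blast+
  have "A ** X = A ** Y ** A ** X" by (simp add: y(1))
  also have "\<dots> = Y ** (A ** X ** A)" by (metis x y matrix_mul_assoc)
  also have "\<dots> = A ** Y" by (simp add: x(1) y(3))
  finally have e: "A ** X = A ** Y" .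
  have "X = X ** (A ** X)" by (simp add: x(2) matrix_mul_assoc)
  also have "\<dots> = X ** A ** Y" by (simp add: e matrix_mul_assoc)
  also have "\<dots> = Y ** A ** Y" by (metis e x(3) y(3))
  finally show ?thesis by (simp add: y(2))
qed

lemma group_inverse_eq: "is_group_inverse A X \<Longrightarrow> A\<^sup># = X"
  unfolding group_inverse_def by (blast intro: is_group_inverse_unique)

text \<open>Dual matrices of dual index one, i.e. those possessing a DGGI.\<close>

definition dual_CM :: "(dual_num^'n^'n) set" where
  "dual_CM = {A. \<exists>X. is_group_inverse A X}"


text \<open>The ranks are compared in \<^typ>\<open>int\<close> because subtraction on \<^typ>\<open>nat\<close> truncates.\<close>

definition minus_le :: "real^'n^'m \<Rightarrow> real^'n^'m \<Rightarrow> bool" where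
  "minus_le E F \<longleftrightarrow> int (rank (F - E)) = int (rank F) - int (rank E)"

text \<open>Both orders on dual matrices carry their domain of definition as a conjunct.\<close>

definition dual_minus_le :: "dual_num^'n^'m \<Rightarrow> dual_num^'n^'m \<Rightarrow> bool" where
  "dual_minus_le A B \<longleftrightarrow>
     has_DMPGI A \<and> has_DMPGI B \<and> minus_le (std_mat A) (std_mat B) \<and> has_DMPGI (B - A)"

definition dual_sharp_le :: "dual_num^'n^'n \<Rightarrow> dual_num^'n^'n \<Rightarrow> bool" where
  "dual_sharp_le A B \<longleftrightarrow>
     A \<in> dual_CM \<and> B \<in> dual_CM \<and> A\<^sup># ** A = A\<^sup># ** B \<and> A ** A\<^sup># = B ** A\<^sup>#"

end

theory Submission
  imports Defs
begin

text \<open>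
  On matrices of index one the sharp order \<open>A \<le> B\<close> amounts to \<open>A\<^sup>2 = A B = B A\<close>. The standard part of
  this is \<open>E\<^sup>2 = E F = F E\<close>, and the infinitesimal part is
  \<open>(F\<^sub>0 - E\<^sub>0) E = (E - F) E\<^sub>0\<close> together with \<open>E (F\<^sub>0 - E\<^sub>0) = E\<^sub>0 (E - F)\<close>.
  Multiplying by \<open>E\<^sup>#\<close> loses nothing, because existence of the DGGI gives
  \<open>(I - E E\<^sup>#) E\<^sub>0 (I - E\<^sup># E) = 0\<close> while \<open>(E - F) E = E (E - F) = 0\<close>.
  The minus order says that the ranges of \<open>E\<close> and \<open>F - E\<close> meet only in \<open>0\<close>; if \<open>E\<close> and \<open>F\<close> commute,
  both ranges contain that of \<open>E (F - E)\<close>, so \<open>E\<^sup>2 = E F\<close>. Finally, a dual matrix has a DMPGI as soon as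
  it has an inner inverse, and \<open>A\<^sup>2 = A B = B A\<close> makes every inner inverse of \<open>B\<close> one of \<open>B - A\<close>.
\<close>

section \<open>Arithmetic of dual matrices in terms of their two real components\<close>

lemma matrix_add_rdistrib:
  fixes A B :: "'a::semiring_1^'n^'m" and C :: "'a^'p^'n"
  shows "(A + B) ** C = A ** C + B ** C"
  by (simp add: vec_eq_iff matrix_matrix_mult_def distrib_right sum.distrib)

lemma matrix_sub_ldistrib:
  fixes A :: "'a::ring_1^'n^'m" and B C :: "'a^'p^'n"
  shows "A ** (B - C) = A ** B - A ** C"
  by (simp add: vec_eq_iff matrix_matrix_mult_def right_diff_distrib sum_subtractf)

lemma matrix_sub_rdistrib:
  fixes A B :: "'a::ring_1^'n^'m" and C :: "'a^'p^'n"
  shows "(A - B) ** C = A ** C - B ** C"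
  by (simp add: vec_eq_iff matrix_matrix_mult_def left_diff_distrib sum_subtractf)

lemma dual_mat_inject [simp]:
  "dual_mat E E0 = dual_mat F F0 \<longleftrightarrow> E = F \<and> E0 = F0"
  by (metis std_mat_dual_mat inf_mat_dual_mat)

lemma sum_Dual: "(\<Sum>k\<in>S. Dual (f k) (g k)) = Dual (sum f S) (sum g S)"
  by (induction S rule: infinite_finite_induct)
    (simp_all add: zero_dual_num_def plus_dual_num_def)

lemma dual_mat_nth: "dual_mat E E0 $ i $ j = Dual (E $ i $ j) (E0 $ i $ j)"
  by (simp add: dual_mat_def dual_num_expansion)

lemma dual_mat_mult:
  "dual_mat E E0 ** dual_mat F F0 = dual_mat (E ** F) (E ** F0 + E0 ** F)"
  by (simp add: vec_eq_iff dual_mat_nth matrix_matrix_mult_def times_dual_num_def sum_Dual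
      sum.distrib)

lemma dual_mat_add: "dual_mat E E0 + dual_mat F F0 = dual_mat (E + F) (E0 + F0)"
  by (simp add: vec_eq_iff dual_mat_nth plus_dual_num_def)

lemma dual_mat_one: "dual_mat (mat 1) 0 = mat 1"
  by (simp add: vec_eq_iff dual_mat_nth mat_def zero_dual_num_def one_dual_num_def)

lemma dual_mat_transpose: "transpose (dual_mat E E0) = dual_mat (transpose E) (transpose E0)"
  by (simp add: vec_eq_iff dual_mat_nth transpose_def)

text \<open>Nilpotency of \<epsilon> stops the Neumann series after one correction: with
  \<open>G\<close> inverse to \<open>E\<close>, the inverse is \<open>G\<close> minus \<epsilon>
  times \<open>G ** E0 ** G\<close>.\<close>

lemma invertible_dual_mat:
  assumes "invertible E"
  shows "invertible (dual_mat E E0)"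
proof -
  obtain G where G: "E ** G = mat 1" "G ** E = mat 1"
    using assms unfolding invertible_def by blast
  let ?X = "dual_mat G (- (G ** E0 ** G))"
  have "E ** (G ** E0 ** G) = E0 ** G" "G ** E0 ** G ** E = G ** E0"
    using G by (metis matrix_mul_assoc matrix_mul_lid, metis matrix_mul_assoc matrix_mul_rid)
  moreover have "E ** (- (G ** E0 ** G)) = - (E ** (G ** E0 ** G))"
    "(- (G ** E0 ** G)) ** E = - (G ** E0 ** G ** E)"
    by (simp_all add: vec_eq_iff matrix_matrix_mult_def sum_negf)
  ultimately have "dual_mat E E0 ** ?X = mat 1" "?X ** dual_mat E E0 = mat 1"
    by (simp_all add: dual_mat_mult G flip: dual_mat_one)
  then show ?thesis unfolding invertible_def by blast
qed

section \<open>Symmetric idempotents and existence of the DMPGI\<close>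

lemma invertible_one_plus_gram:
  fixes M :: "dual_num^'m^'n"
  shows "invertible (mat 1 + M ** transpose M)"
proof -
  define N where "N = std_mat M"
  have "x = 0" if "(mat 1 + N ** transpose N) *v x = 0" for x
  proof -
    \<comment> \<open>Only the standard part matters for invertibility, and there the Gram term
      makes the matrix positive definite.\<close>
    have "x \<bullet> x + (transpose N *v x) \<bullet> (transpose N *v x) = x \<bullet> ((mat 1 + N ** transpose N) *v x)"
      by (simp add: matrix_vector_mult_add_rdistrib inner_add_right dot_lmul_matrix
          vector_transpose_matrix flip: matrix_vector_mul_assoc)
    then show ?thesis using that inner_ge_zero[of x] inner_ge_zero[of "transpose N *v x"]
      by (simp add: add_nonneg_eq_0_iff)
  qed
  then have "invertible (mat 1 + N ** transpose N)"
    using invertible_left_inverse matrix_left_invertible_ker by blast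
  from invertible_dual_mat[OF this] show ?thesis
    unfolding N_def
    by (metis dual_mat_add dual_mat_mult dual_mat_one dual_mat_std_inf dual_mat_transpose)
qed

text \<open>Kaplansky's formula for the symmetric idempotent with the same range as \<open>P\<close>: it is
  \<open>P P\<^sup>T U\<^sup>-\<^sup>1\<close> with \<open>U = I + (P - P\<^sup>T) (P\<^sup>T - P)\<close>, which commutes with \<open>P\<close> and \<open>P\<^sup>T\<close>.\<close>

lemma symmetric_idempotent_same_range:
  fixes P :: "dual_num^'n^'n"
  assumes P: "P ** P = P"
  obtains Q where "transpose Q = Q" "Q ** P = P" "P ** Q = Q"
proof -
  define T where "T = transpose P"
  define U where "U = mat 1 + (P - T) ** (T - P)"
  have T: "T ** T = T" unfolding T_def using P by (metis matrix_transpose_mul)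
  have PT: "transpose (P - T) = T - P" "transpose U = U"
    by (simp_all add: T_def U_def vec_eq_iff transpose_def mat_def matrix_matrix_mult_def algebra_simps)
  have "invertible U"
    unfolding U_def using invertible_one_plus_gram[of "P - T"] PT by simp
  then obtain V where V: "U ** V = mat 1" "V ** U = mat 1"
    unfolding invertible_def by blast
  have U: "U = mat 1 + P ** T - P - T + T ** P"
    unfolding U_def by (simp add: matrix_sub_ldistrib matrix_sub_rdistrib P T)
  have PU: "P ** U = P ** T ** P" and UP: "U ** P = P ** T ** P"
    and TU: "T ** U = T ** P ** T" and UT: "U ** T = T ** P ** T"
    unfolding U
    by (simp_all add: matrix_add_ldistrib matrix_add_rdistrib matrix_sub_ldistrib
        matrix_sub_rdistrib matrix_mul_assoc P T)
       (simp_all add: P T flip: matrix_mul_assoc)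
  have comm: "V ** R = R ** V" if "R ** U = U ** R" for R
    using that V by (metis matrix_mul_assoc matrix_mul_lid matrix_mul_rid)
  have PV: "V ** P = P ** V" and TV: "V ** T = T ** V"
    using comm PU UP TU UT by auto
  have "transpose V = V"
    using V PT(2) by (metis matrix_mul_assoc matrix_mul_lid matrix_mul_rid matrix_transpose_mul transpose_mat)
  then have 1: "transpose (P ** T ** V) = P ** T ** V"
    by (simp add: matrix_transpose_mul T_def matrix_mul_assoc) (metis PV TV T_def matrix_mul_assoc)
  \<comment> \<open>Moving \<open>V\<close> past \<open>P\<close> gives
    \<open>P ** T ** P ** V = P ** U ** V = P\<close>.\<close>
  have 2: "P ** T ** V ** P = P"
    by (metis PU PV V(1) matrix_mul_assoc matrix_mul_rid)
  have 3: "P ** (P ** T ** V) = P ** T ** V"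
    by (simp add: matrix_mul_assoc P)
  from that[OF 1 2 3] show thesis .
qed

text \<open>\<open>A ** Y\<close> and \<open>Y ** A\<close> are idempotent; replacing them by
  symmetric idempotents \<open>Q\<close> (same range) and \<open>R\<close> (same kernel) turns
  \<open>Y\<close> into the DMPGI \<open>R ** Y ** Q\<close>.\<close>

lemma has_DMPGI_if_inner_inverse:
  fixes A :: "dual_num^'n^'m"
  assumes A: "A ** Y ** A = A"
  shows "has_DMPGI A"
proof -
  have "(A ** Y) ** (A ** Y) = A ** Y" using A by (metis matrix_mul_assoc)
  then obtain Q where Q: "transpose Q = Q" "Q ** (A ** Y) = A ** Y" "(A ** Y) ** Q = Q"
    by (rule symmetric_idempotent_same_range)
  \<comment> \<open>Kernels are handled by passing to the transpose, where they become a question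
    about ranges.\<close>
  have "transpose (Y ** A) ** transpose (Y ** A) = transpose (Y ** A)"
    using A by (metis matrix_mul_assoc matrix_transpose_mul)
  then obtain R where R: "transpose R = R" "R ** transpose (Y ** A) = transpose (Y ** A)"
      "transpose (Y ** A) ** R = R"
    by (rule symmetric_idempotent_same_range)
  have R': "(Y ** A) ** R = Y ** A" "R ** (Y ** A) = R"
    using R by (metis matrix_transpose_mul transpose_transpose)+
  have QA: "Q ** A = A" using Q A by (metis matrix_mul_assoc)
  have AR: "A ** R = A" using R' A by (metis matrix_mul_assoc)
  have AX: "A ** (R ** Y ** Q) = Q" using AR Q by (simp add: matrix_mul_assoc)
  have XA: "R ** Y ** Q ** A = R" using QA R' by (simp flip: matrix_mul_assoc)
  have RR: "R ** R = R" using R' AR by (metis matrix_mul_assoc)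
  have "is_DMPGI A (R ** Y ** Q)"
    unfolding is_DMPGI_def AX XA using QA RR Q(1) R(1) by (simp add: matrix_mul_assoc)
  then show ?thesis unfolding has_DMPGI_def by blast
qed

section \<open>The sharp order without group inverses\<close>

lemma group_inverse_square_cancel:
  assumes "is_group_inverse A X"
  shows "X ** (A ** A) = A" "(A ** A) ** X = A" "X ** X ** A = X" "A ** X ** X = X"
  using assms unfolding is_group_inverse_def by (metis matrix_mul_assoc)+

text \<open>Multiplying by \<open>A ** A\<close> removes the factor \<open>X\<close>, and
  multiplying by \<open>X ** X\<close> restores it; this works on either side.\<close>

lemma dual_sharp_le_iff_square:
  assumes "A \<in> dual_CM" "B \<in> dual_CM"
  shows "dual_sharp_le A B \<longleftrightarrow> A ** A = A ** B \<and> A ** A = B ** A"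
proof -
  obtain X where X: "is_group_inverse A X" using assms unfolding dual_CM_def by blast
  note c = group_inverse_square_cancel[OF X]
  have "X ** A = X ** B \<longleftrightarrow> A ** A = A ** B"
  proof
    assume "X ** A = X ** B"
    then have "A ** A ** X ** A = A ** A ** X ** B" by (simp flip: matrix_mul_assoc)
    then show "A ** A = A ** B" by (simp add: c)
  next
    assume "A ** A = A ** B"
    then have "X ** X ** A ** A = X ** X ** A ** B" by (simp flip: matrix_mul_assoc)
    then show "X ** A = X ** B" by (simp add: c)
  qed
  moreover have "A ** X = B ** X \<longleftrightarrow> A ** A = B ** A"
  proof
    assume "A ** X = B ** X"
    then have "A ** (X ** (A ** A)) = B ** (X ** (A ** A))" by (simp add: matrix_mul_assoc)
    then show "A ** A = B ** A" by (simp add: c)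
  next
    assume "A ** A = B ** A"
    then have "A ** (A ** X ** X) = B ** (A ** X ** X)" by (simp add: matrix_mul_assoc)
    then show "A ** X = B ** X" by (simp add: c)
  qed
  ultimately show ?thesis
    using assms unfolding dual_sharp_le_def group_inverse_eq[OF X] by blast
qed

text \<open>Since \<open>A = X ** A ** B = B ** A ** X\<close>, the products
  \<open>A ** Z ** B\<close>, \<open>B ** Z ** A\<close> and \<open>A ** Z ** A\<close> all collapse
  to \<open>A\<close>.\<close>

lemma inner_inverse_diff:
  fixes A B :: "'a::ring_1^'n^'n"
  assumes X: "is_group_inverse A X" and B: "B ** Z ** B = B"
    and AB: "A ** A = A ** B" "A ** A = B ** A"
  shows "(B - A) ** Z ** (B - A) = B - A"
proof -
  note c = group_inverse_square_cancel[OF X]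
  have XAB: "X ** A ** B = A" and BAX: "B ** A ** X = A"
    using c AB by (metis matrix_mul_assoc)+
  have "A ** Z ** B = X ** A ** (B ** Z ** B)"
    by (simp only: matrix_mul_assoc XAB)
  then have 1: "A ** Z ** B = A" by (simp only: B XAB)
  have "B ** Z ** A = (B ** Z ** B) ** (A ** X)"
    by (metis BAX matrix_mul_assoc)
  then have 2: "B ** Z ** A = A" by (simp only: B BAX matrix_mul_assoc)
  have "A ** Z ** A = A ** Z ** B ** (A ** X)"
    by (metis BAX matrix_mul_assoc)
  then have 3: "A ** Z ** A = A" by (simp only: 1 matrix_mul_assoc c)
  show ?thesis
    by (simp add: matrix_sub_ldistrib matrix_sub_rdistrib B 1 2 3)
qed

section \<open>The minus order through ranges and the dimension formula\<close>

lemma range_add_subset: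
  fixes E H :: "real^'n^'m"
  shows "range ((*v) (E + H)) \<subseteq> {x + y |x y. x \<in> range ((*v) E) \<and> y \<in> range ((*v) H)}"
  by (auto simp: matrix_vector_mult_add_rdistrib)

lemma rank_dim_sums_Int:
  fixes E H :: "real^'n^'m"
  shows "dim {x + y |x y. x \<in> range ((*v) E) \<and> y \<in> range ((*v) H)}
    + dim (range ((*v) E) \<inter> range ((*v) H)) = rank E + rank H"
  unfolding rank_dim_range
  by (intro dim_sums_Int linear_subspace_image matrix_vector_mul_linear subspace_UNIV)

lemma minus_le_commute_imp_square:
  fixes E F :: "real^'n^'n"
  assumes "minus_le E F" and EF: "E ** F = F ** E"
  shows "E ** E = E ** F"
proof -
  define H where "H = F - E"
  have EH: "E ** H = H ** E" unfolding H_def by (simp add: matrix_sub_ldistrib matrix_sub_rdistrib EF)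
  have "rank F = rank E + rank H"
    using assms(1) unfolding minus_le_def H_def by linarith
  \<comment> \<open>As \<open>F = E + H\<close>, its range lies in the sum of the two ranges;
    additivity of rank then leaves no dimension for their intersection.\<close>
  moreover have "rank F \<le> dim {x + y |x y. x \<in> range ((*v) E) \<and> y \<in> range ((*v) H)}"
    unfolding rank_dim_range using dim_subset[OF range_add_subset[of E H]] by (simp add: H_def)
  ultimately have "dim (range ((*v) E) \<inter> range ((*v) H)) = 0"
    using rank_dim_sums_Int[of E H] by linarith
  then have disj: "range ((*v) E) \<inter> range ((*v) H) \<subseteq> {0}" by simp
  have "(E ** H) *v x = 0" for x
  proof -
    have "(E ** H) *v x \<in> range ((*v) E)" by (simp flip: matrix_vector_mul_assoc)
    moreover have "(E ** H) *v x \<in> range ((*v) H)" unfolding EH by (simp flip: matrix_vector_mul_assoc)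
    ultimately show ?thesis using disj by blast
  qed
  then have "E ** H = 0" by (simp add: matrix_eq)
  then show ?thesis by (simp add: H_def matrix_sub_ldistrib)
qed

text \<open>If \<open>E *v x = H *v y\<close>, applying \<open>E\<close> kills the right side, and
  \<open>G\<close> recovers \<open>E *v x = 0\<close>. So the ranges meet trivially; their sum is
  the range of \<open>F\<close>, and ranks add.\<close>

lemma minus_le_if_square:
  fixes E F :: "real^'n^'n"
  assumes G: "is_group_inverse E G" and EF: "E ** E = E ** F" "E ** E = F ** E"
  shows "minus_le E F"
proof -
  define H where "H = F - E"
  note c = group_inverse_square_cancel[OF G]
  have EH: "E ** H = 0" by (simp add: H_def matrix_sub_ldistrib EF flip: EF(1))
  have FEG: "F ** (E ** G) = E" using c EF by (metis matrix_mul_assoc)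
  have disj: "range ((*v) E) \<inter> range ((*v) H) \<subseteq> {0}"
  proof clarify
    fix x y assume xy: "E *v x = H *v y"
    have "E *v x = G *v (E *v (E *v x))"
      using c(1) by (metis matrix_vector_mul_assoc)
    also have "E *v (E *v x) = (E ** H) *v y" unfolding xy by (simp add: matrix_vector_mul_assoc)
    finally show "E *v x = 0" by (simp add: EH)
  qed
  have E_F: "E *v x = F *v ((E ** G) *v x)" for x
    by (simp add: matrix_vector_mul_assoc FEG)
  have "{x + y |x y. x \<in> range ((*v) E) \<and> y \<in> range ((*v) H)} \<subseteq> range ((*v) F)"
  proof clarify
    fix x y
    \<comment> \<open>The preimage comes from \<open>E = F ** E ** G\<close> and hence
      \<open>H = F ** (mat 1 - E ** G)\<close>.\<close>
    have "E *v x + H *v y = F *v ((E ** G) *v x + y - (E ** G) *v y)"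
      using E_F[of x] E_F[of y]
      by (simp add: H_def matrix_vector_mult_diff_rdistrib matrix_vector_mult_diff_distrib
          matrix_vector_right_distrib)
    then show "E *v x + H *v y \<in> range ((*v) F)" by blast
  qed
  then have "{x + y |x y. x \<in> range ((*v) E) \<and> y \<in> range ((*v) H)} = range ((*v) F)"
    using range_add_subset[of E H] by (auto simp: H_def)
  then have "dim (range ((*v) F)) + dim (range ((*v) E) \<inter> range ((*v) H)) = rank E + rank H"
    using rank_dim_sums_Int[of E H] by simp
  moreover have "dim (range ((*v) E) \<inter> range ((*v) H)) = 0" using disj by simp
  ultimately have "rank F = rank E + rank H"
    unfolding rank_dim_range[of F] by linarith
  then show ?thesis by (simp add: minus_le_def H_def)
qed

section \<open>Infinitesimal part of the DGGI equations, and the equivalence of the orders\<close>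

lemma is_group_inverse_dual_mat:
  assumes "is_group_inverse (dual_mat E E0) (dual_mat G G0)"
  shows "is_group_inverse E G" and "E0 - E0 ** G ** E - E ** G ** E0 + E ** G ** E0 ** G ** E = 0"
proof -
  have E: "E ** G ** E = E" "G ** E ** G = G" "E ** G = G ** E"
    and E0: "E ** G ** E0 + (E ** G0 + E0 ** G) ** E = E0"
    using assms unfolding is_group_inverse_def dual_mat_mult dual_mat_inject by auto
  then show "is_group_inverse E G" unfolding is_group_inverse_def by simp
  have E0': "E0 = E ** G ** E0 + E ** G0 ** E + E0 ** G ** E"
    using E0 by (simp add: matrix_add_rdistrib algebra_simps)
  \<comment> \<open>Multiplying by \<open>E ** G\<close> expresses the unknown term
    \<open>E ** G0 ** E\<close> through \<open>E0\<close>, which eliminates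
    \<open>G0\<close>.\<close>
  have "E ** G ** E0 = E ** G ** (E ** G ** E0 + E ** G0 ** E + E0 ** G ** E)"
    by (simp flip: E0')
  also have "\<dots> = E ** G ** E0 + E ** G0 ** E + E ** G ** E0 ** G ** E"
    by (simp add: matrix_add_ldistrib matrix_mul_assoc E(1))
  finally have "E ** G0 ** E + E ** G ** E0 ** G ** E = 0" by simp
  moreover have "E0 - E0 ** G ** E - E ** G ** E0 = E ** G0 ** E"
    by (subst (1) E0') simp
  ultimately show "E0 - E0 ** G ** E - E ** G ** E0 + E ** G ** E0 ** G ** E = 0" by simp
qed

theorem theorem3p10:
  fixes E E0 F F0 :: "real^'n^'n"
  assumes "dual_mat E E0 \<in> dual_CM" and "dual_mat F F0 \<in> dual_CM"
  shows "dual_sharp_le (dual_mat E E0) (dual_mat F F0) \<longleftrightarrow>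
    dual_minus_le (dual_mat E E0) (dual_mat F F0) \<and>
    E ** F = F ** E \<and>
    (F0 - E0) ** E ** E\<^sup># = (E - F) ** E0 ** E\<^sup># \<and>
    E ** E\<^sup># ** (F0 - E0) = E\<^sup># ** E0 ** (E - F)"
proof -
  let ?A = "dual_mat E E0" and ?B = "dual_mat F F0"
  obtain X Z where X: "is_group_inverse ?A X" and Z: "is_group_inverse ?B Z"
    using assms unfolding dual_CM_def by blast
  define G where "G = std_mat X"
  have X': "is_group_inverse ?A (dual_mat G (inf_mat X))" using X by (simp add: G_def)
  note G = is_group_inverse_dual_mat(1)[OF X'] and E0 = is_group_inverse_dual_mat(2)[OF X']
  have G': "E ** G ** E = E" "E ** G = G ** E"
    using G unfolding is_group_inverse_def by auto
  note EG = group_inverse_eq[OF G]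
  have sharp: "dual_sharp_le ?A ?B \<longleftrightarrow> E ** E = E ** F \<and> E ** E = F ** E \<and>
      (F0 - E0) ** E = (E - F) ** E0 \<and> E ** (F0 - E0) = E0 ** (E - F)"
    unfolding dual_sharp_le_iff_square[OF assms] dual_mat_mult dual_mat_inject
    by (auto simp: matrix_sub_ldistrib matrix_sub_rdistrib algebra_simps)
  show ?thesis
  proof
    assume L: "dual_sharp_le ?A ?B"
    then have sq: "?A ** ?A = ?A ** ?B" "?A ** ?A = ?B ** ?A"
      using dual_sharp_le_iff_square[OF assms] by auto
    \<comment> \<open>The inner inverses are \<open>X\<close> for \<open>?A\<close> and
      \<open>Z\<close> for both \<open>?B\<close> and \<open>?B - ?A\<close>.\<close>
    have "has_DMPGI ?A" "has_DMPGI ?B" "has_DMPGI (?B - ?A)"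
      using X Z inner_inverse_diff[OF X _ sq] unfolding is_group_inverse_def
      by (blast intro: has_DMPGI_if_inner_inverse)+
    moreover have "minus_le E F" using minus_le_if_square[OF G] L sharp by blast
    ultimately have "dual_minus_le ?A ?B" by (simp add: dual_minus_le_def)
    moreover have "E ** F = F ** E" using L unfolding sharp by metis
    moreover have "(F0 - E0) ** E ** G = (E - F) ** E0 ** G" using L sharp by simp
    moreover have "E ** G ** (F0 - E0) = G ** E0 ** (E - F)"
      using L sharp G'(2) by (metis matrix_mul_assoc)
    ultimately show "dual_minus_le ?A ?B \<and> E ** F = F ** E \<and>
        (F0 - E0) ** E ** E\<^sup># = (E - F) ** E0 ** E\<^sup># \<and>
        E ** E\<^sup># ** (F0 - E0) = E\<^sup># ** E0 ** (E - F)"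
      unfolding EG by blast
  next
    assume "dual_minus_le ?A ?B \<and> E ** F = F ** E \<and>
        (F0 - E0) ** E ** E\<^sup># = (E - F) ** E0 ** E\<^sup># \<and>
        E ** E\<^sup># ** (F0 - E0) = E\<^sup># ** E0 ** (E - F)"
    then have le: "minus_le E F" and comm: "E ** F = F ** E"
      and r: "(F0 - E0) ** E ** G = (E - F) ** E0 ** G"
      and l: "E ** G ** (F0 - E0) = G ** E0 ** (E - F)"
      unfolding EG dual_minus_le_def by simp_all
    have sq: "E ** E = E ** F" by (rule minus_le_commute_imp_square[OF le comm])
    have K: "(E - F) ** E = 0" "E ** (E - F) = 0"
      using sq comm by (simp_all add: matrix_sub_ldistrib matrix_sub_rdistrib)
    \<comment> \<open>The factor \<open>E - F\<close> annihilates the terms beginning with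
      \<open>E\<close>. What remains shows that \<open>G ** E\<close> fixes
      \<open>(E - F) ** E0\<close> from the right, so \<open>r\<close> can be multiplied by
      \<open>E\<close> to cancel \<open>G\<close>.\<close>
    have "0 = (E - F) ** (E0 - E0 ** G ** E - E ** G ** E0 + E ** G ** E0 ** G ** E)"
      using E0 by simp
    also have "\<dots> = (E - F) ** E0 - (E - F) ** E0 ** G ** E"
      by (simp add: matrix_add_ldistrib matrix_sub_ldistrib[of "E - F"] matrix_mul_assoc K)
    finally have r': "(E - F) ** E0 = (E - F) ** E0 ** G ** E" by simp
    have "0 = (E0 - E0 ** G ** E - E ** G ** E0 + E ** G ** E0 ** G ** E) ** (E - F)"
      using E0 by simp
    also have "\<dots> = E0 ** (E - F) - E ** G ** E0 ** (E - F)"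
      by (simp add: matrix_add_rdistrib matrix_sub_rdistrib[of _ _ "E - F"] K flip: matrix_mul_assoc)
    finally have l': "E0 ** (E - F) = E ** G ** E0 ** (E - F)" by simp
    have "(F0 - E0) ** E = (E - F) ** E0"
      using r r' G' by (metis matrix_mul_assoc)
    moreover have "E ** (F0 - E0) = E0 ** (E - F)"
      using l l' G' by (metis matrix_mul_assoc)
    ultimately show "dual_sharp_le ?A ?B" using sharp sq comm by simp
  qed
qed

end
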